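(* For every prime power $q$ and every integer $v>1$, $$N_{v,v}(q)=(q-1)\sum_{0\le u<v}N_{v,u}(q).$$
   Context: Let $q$ be a prime power, $\mathbb{F}_q$ the field with $q$ elements and $\mathcal{P}^1(\mathbb{F}_q)=\mathbb{F}_q\cup\{\infty\}$. Let $V,U$ be nonzero polynomials over $\mathbb{F}_q$ with $\gcd(V,U)=1$, of degrees $v,u$ and leading coefficients $a_v,b_u$. The rational function $V(x)/U(x)$ is evaluated on $\mathcal{P}^1(\mathbb{F}_q)$ as follows: at $a\in\mathbb{F}_q$ its value is $V(a)/U(a)$, understood as $\infty$ if $U(a)=0$; at $\infty$ its value is $\infty$ if $v>u$, $0$ if $v<u$, and $a_v/b_v$ if $v=u$. It is a permutation rational function (PRF) if it permutes $\mathcal{P}^1(\mathbb{F}_q)$. $P_{v,u}(q)$ is the set of PRFs $V(x)/U(x)$ (as rational functions, so $V/U$ and $(cV)/(cU)$ with $c\in\mathbb{F}_q\setminus\{0\}$ are the same element) with $\deg V=v$ and $\deg U=u$, and $N_{v,u}(q)=|P_{v,u}(q)|$. *)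

theory Defs
  imports
    "HOL-Computational_Algebra.Polynomial_Factorial"
    "HOL-Computational_Algebra.Fraction_Field"
    "HOL-Number_Theory.Prime_Powers"
    "HOL-Library.Cardinality"
begin

datatype 'a proj_line = Affine 'a | Infty

text \<open>
  Value of the rational function \<open>V / U\<close> on the projective line. This is meant for nonzero coprime
  \<open>V\<close> and \<open>U\<close>, so that \<open>V\<close> does not vanish at a root of \<open>U\<close>.
\<close>

fun ratfun_eval :: "'a::field poly \<Rightarrow> 'a poly \<Rightarrow> 'a proj_line \<Rightarrow> 'a proj_line" where
  "ratfun_eval V U (Affine a) =
     (if poly U a = 0 then Infty else Affine (poly V a / poly U a))"
| "ratfun_eval V U Infty =
     (if degree V > degree U then Infty
      else if degree V < degree U then Affine 0
      else Affine (lead_coeff V / lead_coeff U))"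

text \<open>
  A coprime pair is determined by its fraction up to a common nonzero constant. Neither the degrees
  nor, by the following lemma, the evaluation depends on that constant.
\<close>

lemma ratfun_eval_smult:
  assumes "c \<noteq> 0"
  shows "ratfun_eval (smult c V) (smult c U) = ratfun_eval V U"
proof
  fix x show "ratfun_eval (smult c V) (smult c U) x = ratfun_eval V U x"
    using assms by (cases x) auto
qed

text \<open>
  The elements are fractions rather than pairs, so \<open>V / U\<close> and \<open>(c V) / (c U)\<close> are counted once.
\<close>

definition prf_set :: "nat \<Rightarrow> nat \<Rightarrow> 'a::{field,finite} poly fract set" where
  "prf_set v u = {Fract V U | V U. V \<noteq> 0 \<and> U \<noteq> 0 \<and> coprime V U \<and>
     degree V = v \<and> degree U = u \<and> bij (ratfun_eval V U)}"

definition prf_count :: "'a::{field,finite} itself \<Rightarrow> nat \<Rightarrow> nat \<Rightarrow> nat" where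
  "prf_count _ v u = card (prf_set v u :: 'a poly fract set)"

end

theory Submission
  imports Defs
begin

text \<open>
  A PRF of degrees \<open>(v, v)\<close> sends \<open>\<infinity>\<close> to some \<open>c \<noteq> 0\<close>, and one of degrees \<open>(v, u)\<close> with \<open>u < v\<close>
  fixes \<open>\<infinity>\<close>. Composition with \<open>y \<mapsto> 1 / y + c\<close> permutes the projective line and sends \<open>V / U\<close> to
  \<open>(U + c V) / V\<close>. Hence it maps the PRFs of degrees \<open>(v, u)\<close>, \<open>u < v\<close>, bijectively onto the PRFs of
  degrees \<open>(v, v)\<close> with value \<open>c\<close> at \<open>\<infinity>\<close>, and there are \<open>q - 1\<close> possibilities for \<open>c\<close>.
\<close>

fun inverse_shift :: "'a::field \<Rightarrow> 'a proj_line \<Rightarrow> 'a proj_line" where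
  "inverse_shift c (Affine a) = (if a = 0 then Infty else Affine (inverse a + c))"
| "inverse_shift c Infty = Affine c"

fun inverse_unshift :: "'a::field \<Rightarrow> 'a proj_line \<Rightarrow> 'a proj_line" where
  "inverse_unshift c (Affine b) = (if b = c then Infty else Affine (inverse (b - c)))"
| "inverse_unshift c Infty = Affine 0"

lemma bij_inverse_shift: "bij (inverse_shift c)"
proof (rule o_bij)
  show "inverse_unshift c \<circ> inverse_shift c = id"
  proof
    fix y show "(inverse_unshift c \<circ> inverse_shift c) y = id y" by (cases y) auto
  qed
  show "inverse_shift c \<circ> inverse_unshift c = id"
  proof
    fix y show "(inverse_shift c \<circ> inverse_unshift c) y = id y" by (cases y) auto
  qed
qed

lemma degree_lead_coeff_add_smult:
  fixes U V :: "'a::field poly"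
  assumes "degree U < degree V" "c \<noteq> 0"
  shows "degree (U + smult c V) = degree V"
    and "lead_coeff (U + smult c V) = c * lead_coeff V"
proof -
  show deg: "degree (U + smult c V) = degree V"
    using assms by (simp add: degree_add_eq_right)
  show "lead_coeff (U + smult c V) = c * lead_coeff V"
    unfolding deg using assms by (simp add: coeff_eq_0)
qed

lemma coprime_add_smult_left_iff:
  fixes U V :: "'a::field poly"
  shows "coprime (U + smult c V) V \<longleftrightarrow> coprime V U"
proof -
  have "d dvd U + smult c V \<longleftrightarrow> d dvd U" if "d dvd V" for d
    using that by (simp add: dvd_add_left_iff dvd_smult)
  then show ?thesis
    unfolding coprime_def by blast
qed

lemma coprime_poly_no_common_root:
  fixes V U :: "'a::field poly"
  assumes "coprime V U" "poly V a = 0"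
  shows "poly U a \<noteq> 0"
proof
  assume "poly U a = 0"
  with assms have "is_unit [:- a, 1:]"
    by (auto simp: poly_eq_0_iff_dvd intro: coprime_common_divisor)
  then show False
    by (simp add: is_unit_iff_degree)
qed

text \<open>Three kinds of points need care. At a root of \<open>U\<close> the value \<infinity>
  goes to \<open>c\<close>. At a root of \<open>V\<close> coprimality gives the value 0 and not
  \<infinity>, and 0 goes to \<infinity>. At \<infinity> the quotient of the leading coefficients is
  \<open>c\<close>.\<close>

lemma ratfun_eval_inverse_shift:
  assumes "coprime V U" "degree U < degree V" "c \<noteq> 0"
  shows "ratfun_eval (U + smult c V) V = inverse_shift c \<circ> ratfun_eval V U"
proof
  fix x
  show "ratfun_eval (U + smult c V) V x = (inverse_shift c \<circ> ratfun_eval V U) x"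
  proof (cases x)
    case (Affine a)
    then show ?thesis
      using coprime_poly_no_common_root[OF assms(1), of a] by (auto simp: field_simps)
  next
    case Infty
    have "V \<noteq> 0" using assms(2) by auto
    then show ?thesis
      using Infty assms degree_lead_coeff_add_smult[OF assms(2,3)] by auto
  qed
qed

text \<open>Composing with a permutation neither creates nor destroys bijectivity. Each direction
  serves one inclusion in the image computation of \<open>bij_betw_prf_set\<close>.\<close>

lemma bij_ratfun_eval_inverse_shift_iff:
  assumes "coprime V U" "degree U < degree V" "c \<noteq> 0"
  shows "bij (ratfun_eval (U + smult c V) V) \<longleftrightarrow> bij (ratfun_eval V U)"
  using bij_inverse_shift[of c] unfolding ratfun_eval_inverse_shift[OF assms]
  by (metis bij_betw_comp_iff2 bij_comp bij_is_inj bij_def subset_UNIV)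

lemma inverse_Fract_add_const:
  fixes V U :: "'a::field poly"
  assumes "V \<noteq> 0"
  shows "inverse (Fract V U) + Fract [:c:] 1 = Fract (U + smult c V) V"
  using assms by simp

text \<open>The constant is recovered as the value at \<infinity>: a difference of two proper
  fractions is proper, so it cannot be a nonzero constant. After cross-multiplication this is a
  comparison of degrees.\<close>

lemma inverse_Fract_add_const_eqD:
  fixes V U V' U' :: "'a::field poly"
  assumes "Fract (U + smult c V) V = Fract (U' + smult c' V') V'"
    and "degree U < degree V" "degree U' < degree V'"
  shows "c = c'"
proof (rule ccontr)
  assume "c \<noteq> c'"
  have nz: "V \<noteq> 0" "V' \<noteq> 0" using assms by auto
  then have "(U + smult c V) * V' = (U' + smult c' V') * V"
    using assms(1) by (simp add: eq_fract)
  then have "U * V' - U' * V = smult (c' - c) (V * V')"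
    by (simp add: algebra_simps smult_diff_left)
  moreover have "degree (U * V' - U' * V) < degree V + degree V'"
    using assms(2,3) degree_mult_le[of U V'] degree_mult_le[of U' V]
    by (intro degree_diff_less) auto
  ultimately show False
    using \<open>c \<noteq> c'\<close> nz by (simp add: degree_mult_eq)
qed

lemma finite_degree_le: "finite {p :: 'a::{zero,finite} poly. degree p \<le> n}"
proof (rule finite_subset)
  show "{p :: 'a poly. degree p \<le> n} \<subseteq> Poly ` {xs. set xs \<subseteq> UNIV \<and> length xs \<le> Suc n}"
  proof
    fix p :: "'a poly" assume "p \<in> {p. degree p \<le> n}"
    then have "length (coeffs p) \<le> Suc n"
      by (cases "p = 0") (auto simp: length_coeffs_degree)
    then show "p \<in> Poly ` {xs. set xs \<subseteq> UNIV \<and> length xs \<le> Suc n}"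
      by (intro image_eqI[of _ _ "coeffs p"]) auto
  qed
qed (intro finite_imageI finite_lists_length_le finite)

lemma finite_prf_set: "finite (prf_set v u :: 'a::{field,finite} poly fract set)"
proof (rule finite_subset)
  show "(prf_set v u :: 'a poly fract set)
      \<subseteq> (\<lambda>(V, U). Fract V U) ` ({V. degree V \<le> v} \<times> {U. degree U \<le> u})"
    unfolding prf_set_def by auto
qed (intro finite_imageI finite_cartesian_product finite_degree_le)

text \<open>The difference between the degrees of numerator and denominator is an invariant of the
  fraction, so fixing \<open>v\<close> determines \<open>u\<close>.\<close>

lemma prf_set_disjoint:
  assumes "u \<noteq> u'"
  shows "prf_set v u \<inter> prf_set v u' = {}"
proof -
  have "degree U = degree U'"
    if "Fract V U = Fract V' U'" "degree V = degree V'" "V \<noteq> 0" "U \<noteq> 0" "V' \<noteq> 0" "U' \<noteq> 0"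
    for V U V' U' :: "'a poly"
  proof -
    have "V * U' = V' * U" using that by (simp add: eq_fract)
    then have "degree (V * U') = degree (V' * U)" by simp
    then show ?thesis using that by (simp add: degree_mult_eq)
  qed
  then show ?thesis
    using assms unfolding prf_set_def by (smt (verit) disjoint_iff mem_Collect_eq)
qed

lemma bij_betw_prf_set:
  assumes "v > 0"
  shows "bij_betw (\<lambda>(c, r). inverse r + Fract [:c:] 1)
    ((UNIV - {0 :: 'a::{field,finite}}) \<times> (\<Union>u<v. prf_set v u)) (prf_set v v)"
    (is "bij_betw ?f ?A _")
proof (rule bij_betw_imageI)
  have rep: "\<exists>V U. r = Fract V U \<and> V \<noteq> 0 \<and> U \<noteq> 0 \<and> coprime V U \<and> degree V = v \<and>
      degree U < v \<and> bij (ratfun_eval V U)"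
    if "r \<in> (\<Union>u<v. prf_set v u)" for r :: "'a poly fract"
    using that unfolding prf_set_def by auto
  show "inj_on ?f ?A"
  proof (rule inj_onI)
    fix x y assume "x \<in> ?A" "y \<in> ?A" and f: "?f x = ?f y"
    then obtain c r c' r' where xy: "x = (c, r)" "y = (c', r')"
      and r: "r \<in> (\<Union>u<v. prf_set v u)" and r': "r' \<in> (\<Union>u<v. prf_set v u)"
      by blast
    have eq: "inverse r + Fract [:c:] 1 = inverse r' + Fract [:c':] 1"
      using f by (simp add: xy)
    obtain V U where VU: "r = Fract V U" "V \<noteq> 0" "degree U < degree V"
      using rep[OF r] by blast
    obtain V' U' where VU': "r' = Fract V' U'" "V' \<noteq> 0" "degree U' < degree V'"
      using rep[OF r'] by blast
    have "c = c'"
      using eq VU VU' by (metis inverse_Fract_add_const inverse_Fract_add_const_eqD)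
    with eq show "x = y" by (simp add: xy)
  qed
  show "?f ` ?A = prf_set v v"
  proof (intro equalityI subsetI)
    fix s assume "s \<in> ?f ` ?A"
    then obtain c r where cr: "c \<noteq> 0" "r \<in> (\<Union>u<v. prf_set v u)"
      and s: "s = inverse r + Fract [:c:] 1"
      by auto
    obtain V U where VU: "r = Fract V U" "V \<noteq> 0" "coprime V U" "degree V = v" "degree U < degree V"
        "bij (ratfun_eval V U)"
      using rep[OF cr(2)] by auto
    have deg: "degree (U + smult c V) = v"
      using degree_lead_coeff_add_smult(1)[OF VU(5) cr(1)] VU(4) by simp
    have "s = Fract (U + smult c V) V"
      using s VU inverse_Fract_add_const by simp
    \<comment> \<open>The zero polynomial has degree 0, whereas \<open>v\<close> is
      positive.\<close>
    moreover have "U + smult c V \<noteq> 0"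
      using deg assms by auto
    moreover have "coprime (U + smult c V) V"
      using VU(3) by (simp only: coprime_add_smult_left_iff)
    moreover have "bij (ratfun_eval (U + smult c V) V)"
      using bij_ratfun_eval_inverse_shift_iff[OF VU(3,5) cr(1)] VU(6) by simp
    ultimately show "s \<in> prf_set v v"
      unfolding prf_set_def using VU(2,4) deg by blast
  next
    fix s :: "'a poly fract" assume "s \<in> prf_set v v"
    then obtain V U where VU: "s = Fract V U" "V \<noteq> 0" "U \<noteq> 0" "coprime V U" "degree V = v"
        "degree U = v" "bij (ratfun_eval V U)"
      unfolding prf_set_def by auto
    \<comment> \<open>The value of \<open>V / U\<close> at \<infinity> is the only candidate for
      \<open>c\<close>. Subtracting it leaves \<open>W / U\<close>, whose inverse
      \<open>U / W\<close> is the preimage sought.\<close>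
    define c where "c = lead_coeff V / lead_coeff U"
    define W where "W = V - smult c U"
    have c: "c \<noteq> 0" using VU(2,3) by (simp add: c_def)
    have V: "V = W + smult c U" by (simp add: W_def)
    have cop: "coprime U W" using VU(4) unfolding V coprime_add_smult_left_iff .
    \<comment> \<open>Otherwise \<open>V / U\<close> would be constant, and coprimality would make
      \<open>U\<close> a unit, against \<open>v > 0\<close>.\<close>
    have "W \<noteq> 0"
    proof
      assume "W = 0"
      with cop have "degree U = 0" using is_unit_iff_degree[OF VU(3)] by simp
      with VU(6) assms show False by simp
    qed
    \<comment> \<open>The choice of \<open>c\<close> cancels the terms of degree \<open>v\<close>;
      as \<open>W\<close> is nonzero, its degree cannot be \<open>v\<close>.\<close>
    have "coeff U v \<noteq> 0" using VU(3,6) by auto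
    then have "coeff W v = 0" using VU(5,6) by (simp add: W_def c_def)
    moreover have "degree W \<le> v" unfolding W_def using VU by (intro degree_diff_le) auto
    ultimately have deg: "degree W < v"
      using \<open>W \<noteq> 0\<close> by (metis le_neq_implies_less leading_coeff_0_iff)
    have "bij (ratfun_eval U W)"
      using VU(7) bij_ratfun_eval_inverse_shift_iff[OF cop _ c] deg VU(6) unfolding V by simp
    then have "Fract U W \<in> prf_set v (degree W)"
      unfolding prf_set_def using VU(3,6) \<open>W \<noteq> 0\<close> cop by blast
    moreover have "s = ?f (c, Fract U W)"
      using VU(1,3) inverse_Fract_add_const[of U W c] by (simp add: V)
    ultimately show "s \<in> ?f ` ?A"
      using c deg by blast
  qed
qed

theorem theorem2p3:
  fixes q v :: nat
  assumes "primepow q"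
    and "CARD('a::{field,finite}) = q"
    and "v > 1"
  shows "prf_count TYPE('a) v v = (q - 1) * (\<Sum>u<v. prf_count TYPE('a) v u)"
proof -
  \<comment> \<open>Disjointness and finiteness turn the second factor of the bijection's domain
    into the sum; the first factor contributes \<open>q - 1\<close>.\<close>
  have "card (\<Union>u<v. prf_set v u :: 'a poly fract set) = (\<Sum>u<v. prf_count TYPE('a) v u)"
    unfolding prf_count_def
    by (intro card_UN_disjoint) (auto simp: finite_prf_set dest: prf_set_disjoint)
  moreover have "card (UNIV - {0 :: 'a}) = q - 1"
    using assms(2) by (simp add: card_Diff_singleton)
  ultimately show ?thesis
    using bij_betw_same_card[OF bij_betw_prf_set[of v, where 'a = 'a]] assms(3)
    by (simp add: card_cartesian_product prf_count_def)
qed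

end
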